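(* Suppose $X\sim\mathrm{Poisson}(\lambda)$ and $N$ is a positive integer. Then the ratio $$\frac{\mathbb{E}[X_N^2]}{\mathbb{E}[X_N]}$$ is increasing with respect to $\lambda$.
   Context: For a non-negative integer-valued random variable $X$ and a positive integer $N$, $X_N$ denotes the truncated random variable $X_N=\min(X,N)$. $\mathrm{Poisson}(\lambda)$ is the Poisson distribution with rate parameter $\lambda>0$. *)

theory Defs
  imports "HOL-Probability.Probability"
begin

definition truncated :: "('a \<Rightarrow> nat) \<Rightarrow> nat \<Rightarrow> 'a \<Rightarrow> nat" where
  "truncated X N = (\<lambda>\<omega>. min (X \<omega>) N)"

(* The library's pmf poisson_pmf is specified for positive rates only, hence the conjunct 0 < rate. *)
definition poisson_distributed :: "'a measure \<Rightarrow> ('a \<Rightarrow> nat) \<Rightarrow> real \<Rightarrow> bool" where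
  "poisson_distributed M X rate \<longleftrightarrow>
     0 < rate \<and> X \<in> measurable M (count_space UNIV) \<and>
     distr M (count_space UNIV) X = measure_pmf (poisson_pmf rate)"

end

theory Submission
  imports Defs
begin

text \<open>
  For positive rates \<open>r \<le> s\<close> the likelihood ratio of the Poisson distributions with rates \<open>s\<close> and \<open>r\<close>
  is \<open>n \<mapsto> exp (r - s) * (s / r) ^ n\<close>, an increasing function of the value \<open>n\<close>.
  With \<open>g n = min n N\<close>, the ratio of the functions \<open>g\<^sup>2\<close> and \<open>g\<close> that are being averaged is \<open>g\<close>, which is
  increasing as well. The claim is an instance of the principle that two such monotone ratios are
  positively correlated: the difference of the two cross products of expectations is half the sum over
  all pairs \<open>(m, n)\<close> of a product of two determinants, one made of the averaged functions and the
  other of the probability masses (the Cauchy--Binet identity), and by the two monotonicities these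
  determinants never have opposite signs. Cross products are used instead of ratios because \<open>g\<close>
  vanishes at \<open>n = 0\<close>; only the two expectations of \<open>g\<close> are divided by, and these are positive.
\<close>

lemma Cauchy_Binet_two_rows:
  fixes a b p q :: "'i \<Rightarrow> 'r :: comm_ring_1"
  shows "(\<Sum>m\<in>S. \<Sum>n\<in>S. (a m * b n - a n * b m) * (q m * p n - q n * p m)) =
    2 * ((\<Sum>n\<in>S. a n * q n) * (\<Sum>n\<in>S. b n * p n) - (\<Sum>n\<in>S. a n * p n) * (\<Sum>n\<in>S. b n * q n))"
    (is "?L = 2 * (?aq * ?bp - ?ap * ?bq)")
proof -
  have "?L = (\<Sum>m\<in>S. \<Sum>n\<in>S. (a m * q m) * (b n * p n) - (a m * p m) * (b n * q n)
      - (b m * q m) * (a n * p n) + (b m * p m) * (a n * q n))"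
    by (intro sum.cong refl) (simp add: algebra_simps)
  also have "\<dots> = ?aq * ?bp - ?ap * ?bq - ?bq * ?ap + ?bp * ?aq"
    by (simp add: sum.distrib sum_subtractf sum_product)
  finally show ?thesis
    by (simp add: algebra_simps)
qed

text \<open>
  In the sum of the Cauchy--Binet identity both determinants change sign when \<open>m\<close> and \<open>n\<close> are swapped,
  so it suffices that they are nonnegative for \<open>n \<le> m\<close>.
\<close>

lemma sum_cross_product_mono:
  fixes a b p q :: "'i :: linorder \<Rightarrow> real"
  assumes ab: "\<And>m n. n \<le> m \<Longrightarrow> a n * b m \<le> a m * b n"
    and qp: "\<And>m n. n \<le> m \<Longrightarrow> q n * p m \<le> q m * p n"
  shows "(\<Sum>n\<in>S. a n * p n) * (\<Sum>n\<in>S. b n * q n) \<le> (\<Sum>n\<in>S. a n * q n) * (\<Sum>n\<in>S. b n * p n)"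
proof -
  have "0 \<le> (a m * b n - a n * b m) * (q m * p n - q n * p m)" for m n
  proof (cases "n \<le> m")
    case True
    then show ?thesis
      using ab[OF True] qp[OF True] by simp
  next
    case False
    then have "m \<le> n"
      by simp
    from ab[OF this] qp[OF this] show ?thesis
      by (intro mult_nonpos_nonpos) auto
  qed
  then have "0 \<le> (\<Sum>m\<in>S. \<Sum>n\<in>S. (a m * b n - a n * b m) * (q m * p n - q n * p m))"
    by (intro sum_nonneg)
  then show ?thesis
    unfolding Cauchy_Binet_two_rows by simp
qed

lemma sums_expectation_pmf_nat:
  fixes f :: "nat \<Rightarrow> real"
  assumes "integrable (measure_pmf p) f"
  shows "(\<lambda>n. f n * pmf p n) sums measure_pmf.expectation p f"
proof -
  have "integrable (count_space UNIV) (\<lambda>n. pmf p n *\<^sub>R f n)"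
    using assms unfolding measure_pmf_eq_density by (subst (asm) integrable_density) auto
  moreover have "measure_pmf.expectation p f = (LINT n|count_space UNIV. pmf p n *\<^sub>R f n)"
    unfolding measure_pmf_eq_density by (subst integral_density) auto
  ultimately show ?thesis
    using sums_integral_count_space_nat[of "\<lambda>n. pmf p n *\<^sub>R f n"] by (simp add: mult.commute)
qed

text \<open>
  The inequality for finite sums passes to the limit. Its two hypotheses say, free of division, that
  \<open>a / b\<close> and the likelihood ratio of \<open>q\<close> to \<open>p\<close> are increasing.
\<close>

lemma expectation_cross_product_mono:
  fixes a b :: "nat \<Rightarrow> real" and p q :: "nat pmf"
  assumes ab: "\<And>m n. n \<le> m \<Longrightarrow> a n * b m \<le> a m * b n"
    and qp: "\<And>m n. n \<le> m \<Longrightarrow> pmf q n * pmf p m \<le> pmf q m * pmf p n"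
    and int: "integrable (measure_pmf p) a" "integrable (measure_pmf q) a"
      "integrable (measure_pmf p) b" "integrable (measure_pmf q) b"
  shows "measure_pmf.expectation p a * measure_pmf.expectation q b
    \<le> measure_pmf.expectation q a * measure_pmf.expectation p b"
proof (rule LIMSEQ_le)
  note lims = int[THEN sums_expectation_pmf_nat, unfolded sums_def]
  show "(\<lambda>K. (\<Sum>n<K. a n * pmf p n) * (\<Sum>n<K. b n * pmf q n))
      \<longlonglongrightarrow> measure_pmf.expectation p a * measure_pmf.expectation q b"
    by (intro tendsto_mult lims)
  show "(\<lambda>K. (\<Sum>n<K. a n * pmf q n) * (\<Sum>n<K. b n * pmf p n))
      \<longlonglongrightarrow> measure_pmf.expectation q a * measure_pmf.expectation p b"
    by (intro tendsto_mult lims)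
  show "\<exists>K0. \<forall>K\<ge>K0. (\<Sum>n<K. a n * pmf p n) * (\<Sum>n<K. b n * pmf q n)
      \<le> (\<Sum>n<K. a n * pmf q n) * (\<Sum>n<K. b n * pmf p n)"
    using sum_cross_product_mono[of a b "pmf q" "pmf p", OF ab qp] by blast
qed

lemma poisson_monotone_likelihood_ratio:
  assumes "0 < r" "r \<le> s" "n \<le> m"
  shows "pmf (poisson_pmf s) n * pmf (poisson_pmf r) m
    \<le> pmf (poisson_pmf s) m * pmf (poisson_pmf r) n"
proof -
  obtain d where m: "m = n + d"
    using assms(3) le_Suc_ex by blast
  have "s ^ n * r ^ n * r ^ d \<le> s ^ n * r ^ n * s ^ d"
    using assms by (intro mult_left_mono power_mono) auto
  then have "s ^ n * r ^ m \<le> s ^ m * r ^ n"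
    by (simp add: m power_add mult_ac)
  then have "(s ^ n * r ^ m) * (exp (- s) * exp (- r) / (fact n * fact m))
      \<le> (s ^ m * r ^ n) * (exp (- s) * exp (- r) / (fact n * fact m))"
    by (rule mult_right_mono) simp
  then show ?thesis
    using assms by (simp add: mult_ac)
qed

lemma integrable_pmf_truncated:
  fixes f :: "nat \<Rightarrow> real"
  shows "integrable (measure_pmf p) (\<lambda>n. f (min n N))"
proof (rule measure_pmf.integrable_const_bound)
  show "AE n in measure_pmf p. norm (f (min n N)) \<le> (\<Sum>k\<le>N. \<bar>f k\<bar>)"
    by (intro AE_I2) (auto intro!: member_le_sum)
qed simp

text \<open>Positivity comes from the atom at \<open>1\<close>.\<close>

lemma expectation_poisson_truncated_pos:
  assumes "0 < r" "0 < N"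
  shows "0 < measure_pmf.expectation (poisson_pmf r) (\<lambda>n. real (min n N))"
proof -
  note sums = sums_expectation_pmf_nat[OF integrable_pmf_truncated[of "poisson_pmf r" real N]]
  have "0 < (\<Sum>n. real (min n N) * pmf (poisson_pmf r) n)"
    using assms by (intro suminf_pos2[where i = 1] sums_summable[OF sums]) auto
  then show ?thesis
    using sums_unique[OF sums] by simp
qed

lemma expectation_poisson_distributed:
  fixes f :: "nat \<Rightarrow> real"
  assumes "poisson_distributed M X r"
  shows "integral\<^sup>L M (\<lambda>\<omega>. f (truncated X N \<omega>))
    = measure_pmf.expectation (poisson_pmf r) (\<lambda>n. f (min n N))"
proof -
  have X: "X \<in> measurable M (count_space UNIV)"
    and distr: "distr M (count_space UNIV) X = measure_pmf (poisson_pmf r)"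
    using assms unfolding poisson_distributed_def by auto
  show ?thesis
    unfolding distr[symmetric] truncated_def by (subst integral_distr[OF X]) auto
qed

theorem lemma4p4:
  fixes M :: "real \<Rightarrow> 'a measure" and X :: "real \<Rightarrow> 'a \<Rightarrow> nat" and N :: nat
  assumes "\<And>rate. 0 < rate \<Longrightarrow> prob_space (M rate)"
    and "\<And>rate. 0 < rate \<Longrightarrow> poisson_distributed (M rate) (X rate) rate"
    and "0 < N"
  shows "mono_on {0<..}
    (\<lambda>rate. prob_space.expectation (M rate) (\<lambda>\<omega>. (real (truncated (X rate) N \<omega>))\<^sup>2)
        / prob_space.expectation (M rate) (\<lambda>\<omega>. real (truncated (X rate) N \<omega>)))"
proof (rule mono_onI)
  fix r s :: real
  assume "r \<in> {0<..}" "s \<in> {0<..}" and rs: "r \<le> s"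
  then have r: "0 < r" and s: "0 < s"
    by auto
  let ?g = "\<lambda>n. real (min n N)"
  let ?E = "\<lambda>rate. measure_pmf.expectation (poisson_pmf rate)"
  have "(?g n)\<^sup>2 * ?g m \<le> (?g m)\<^sup>2 * ?g n" if "n \<le> m" for m n
  proof -
    have "(?g n * ?g m) * ?g n \<le> (?g n * ?g m) * ?g m"
      using that by (intro mult_left_mono) auto
    then show ?thesis
      by (simp add: power2_eq_square mult_ac)
  qed
  then have "?E r (\<lambda>n. (?g n)\<^sup>2) * ?E s ?g \<le> ?E s (\<lambda>n. (?g n)\<^sup>2) * ?E r ?g"
    by (intro expectation_cross_product_mono poisson_monotone_likelihood_ratio[OF r rs]
        integrable_pmf_truncated[of _ real] integrable_pmf_truncated[of _ "\<lambda>k. (real k)\<^sup>2"])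
  then have "?E r (\<lambda>n. (?g n)\<^sup>2) / ?E r ?g \<le> ?E s (\<lambda>n. (?g n)\<^sup>2) / ?E s ?g"
    using expectation_poisson_truncated_pos[OF r \<open>0 < N\<close>] expectation_poisson_truncated_pos[OF s \<open>0 < N\<close>]
    by (simp add: divide_simps mult_ac)
  then show "(LINT \<omega>|M r. (real (truncated (X r) N \<omega>))\<^sup>2) / (LINT \<omega>|M r. real (truncated (X r) N \<omega>))
      \<le> (LINT \<omega>|M s. (real (truncated (X s) N \<omega>))\<^sup>2) / (LINT \<omega>|M s. real (truncated (X s) N \<omega>))"
    using assms(2)[OF r] assms(2)[OF s]
    by (simp only: expectation_poisson_distributed[where f = real]
        expectation_poisson_distributed[where f = "\<lambda>k. (real k)\<^sup>2"])
qed

end
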